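(* Let $M\ge 0$ and $r\ge 1$ be integers, let $0\le x_1<x_2<\dots<x_r\le 1$ be sampling points, let $s=\{s_j\}_{j=1}^r$ be real sampling values and let $\{w_j\}_{j=1}^r$ be positive weights. Let $V$ be the real $r\times(M+1)$ matrix with rows indexed by $j=1,\dots,r$ and columns indexed by $k=0,\dots,M$, $$V_{j,0}=\tfrac{1}{\sqrt2}\sqrt{w_j},\qquad V_{j,k}=\sqrt{w_j}\,\cos(\pi k x_j)\quad (k=1,\dots,M),$$ let $s^{(w)}=\{\sqrt{w_j}\,s_j\}_{j=1}^r$, and put $A:=V^TV$, $b:=V^Ts^{(w)}$. Then the following hold. (i) $A=D(T+H)D$, where $D=\operatorname{diag}(\tfrac1{\sqrt2},1,\dots,1)$ is of size $(M+1)\times(M+1)$, and $T$, $H$ are the $(M+1)\times(M+1)$ Toeplitz and Hankel matrices with entries $$T_{k,l}=a_{|k-l|},\qquad H_{k,l}=a_{k+l},\qquad k,l=0,\dots,M,$$ with $$a_k=\frac12\sum_{j=1}^r w_j\cos(\pi k x_j).$$ (ii) If $M<r$, then $A$ is invertible and the coefficient vector $c=\{c_k\}_{k=0}^M$ of the cosine polynomial $p\in\boldsymbol P_{\!M}$ that solves the least squares problem $$\min_{p\in \boldsymbol P_{\!M}}\ \sum_{j=1}^r |p(x_j)-s_j|^2 w_j$$ is given by $c=A^{-1}b$. (iii) Let $M\ge 1$, set $x_0:=-x_1$ and $x_{r+1}:=2-x_r$, and let the weights be defined by $$w_j=\frac{x_{j+1}-x_{j-1}}{2},\qquad j=1,\dots,r.$$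 If $$\delta:=\max_{0\le j\le r}|x_{j+1}-x_j|<\frac1M,$$ then the condition number $\kappa(A)$ satisfies $$\kappa(A)\le\frac{(1+\delta M)^2}{(1-\delta M)^2}.$$
   Context: $\boldsymbol P_{\!M}$ denotes the space of cosine polynomials of maximal degree $M$, i.e. functions of the form $p(x)=\frac{c_0}{\sqrt2}+\sum_{k=1}^M c_k\cos(\pi kx)$ with coefficient vector $c=\{c_k\}_{k=0}^M\in\mathbb R^{M+1}$. The condition number $\kappa(A)$ is the one with respect to the Euclidean operator norm, $\kappa(A)=\|A\|_{\mathrm{op}}\|A^{-1}\|_{\mathrm{op}}$. *)

theory Defs
  imports Complex_Main "Jordan_Normal_Form.Matrix"
    "Jordan_Normal_Form.Gauss_Jordan_Elimination"
begin

(* Families indexed by j = 1, ..., r (points, values, weights) are functions on nat whose values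
   outside {1..r} are irrelevant.  Matrix rows are 0-based, so row i belongs to the index j = i + 1;
   coefficient indices k = 0, ..., M are 0-based already. *)

definition cos_poly :: "nat \<Rightarrow> real vec \<Rightarrow> real \<Rightarrow> real" where
  "cos_poly M c x = vec_index c 0 / sqrt 2 + (\<Sum>k=1..M. vec_index c k * cos (pi * real k * x))"

definition cos_polys :: "nat \<Rightarrow> (real \<Rightarrow> real) set" where
  "cos_polys M = {cos_poly M c | c. c \<in> carrier_vec (M + 1)}"

definition sampling_mat :: "nat \<Rightarrow> nat \<Rightarrow> (nat \<Rightarrow> real) \<Rightarrow> (nat \<Rightarrow> real) \<Rightarrow> real mat" where
  "sampling_mat M r x w = mat r (M + 1) (\<lambda>(i, k).
     if k = 0 then 1 / sqrt 2 * sqrt (w (i + 1))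
     else sqrt (w (i + 1)) * cos (pi * real k * x (i + 1)))"

definition weighted_samples :: "nat \<Rightarrow> (nat \<Rightarrow> real) \<Rightarrow> (nat \<Rightarrow> real) \<Rightarrow> real vec" where
  "weighted_samples r w s = vec r (\<lambda>i. sqrt (w (i + 1)) * s (i + 1))"

definition gram_mat :: "nat \<Rightarrow> nat \<Rightarrow> (nat \<Rightarrow> real) \<Rightarrow> (nat \<Rightarrow> real) \<Rightarrow> real mat" where
  "gram_mat M r x w = transpose_mat (sampling_mat M r x w) * sampling_mat M r x w"

definition normal_rhs ::
    "nat \<Rightarrow> nat \<Rightarrow> (nat \<Rightarrow> real) \<Rightarrow> (nat \<Rightarrow> real) \<Rightarrow> (nat \<Rightarrow> real) \<Rightarrow> real vec" where
  "normal_rhs M r x w s = transpose_mat (sampling_mat M r x w) *\<^sub>v weighted_samples r w s"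

definition cos_moment :: "nat \<Rightarrow> (nat \<Rightarrow> real) \<Rightarrow> (nat \<Rightarrow> real) \<Rightarrow> nat \<Rightarrow> real" where
  "cos_moment r x w k = 1 / 2 * (\<Sum>j=1..r. w j * cos (pi * real k * x j))"

definition scale_mat :: "nat \<Rightarrow> real mat" where
  "scale_mat M = mat_diag (M + 1) (\<lambda>k. if k = 0 then 1 / sqrt 2 else 1)"

definition toeplitz_mat :: "nat \<Rightarrow> (nat \<Rightarrow> real) \<Rightarrow> real mat" where
  "toeplitz_mat M a = mat (M + 1) (M + 1) (\<lambda>(k, l). a (nat \<bar>int k - int l\<bar>))"

definition hankel_mat :: "nat \<Rightarrow> (nat \<Rightarrow> real) \<Rightarrow> real mat" where
  "hankel_mat M a = mat (M + 1) (M + 1) (\<lambda>(k, l). a (k + l))"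

definition lsq_error ::
    "nat \<Rightarrow> (nat \<Rightarrow> real) \<Rightarrow> (nat \<Rightarrow> real) \<Rightarrow> (nat \<Rightarrow> real) \<Rightarrow> (real \<Rightarrow> real) \<Rightarrow> real" where
  "lsq_error r x w s p = (\<Sum>j=1..r. \<bar>p (x j) - s j\<bar>\<^sup>2 * w j)"

definition ext_points :: "nat \<Rightarrow> (nat \<Rightarrow> real) \<Rightarrow> nat \<Rightarrow> real" where
  "ext_points r x j = (if j = 0 then - x 1 else if j = r + 1 then 2 - x r else x j)"

definition adaptive_weight :: "nat \<Rightarrow> (nat \<Rightarrow> real) \<Rightarrow> nat \<Rightarrow> real" where
  "adaptive_weight r x j = (ext_points r x (j + 1) - ext_points r x (j - 1)) / 2"

definition max_gap :: "nat \<Rightarrow> (nat \<Rightarrow> real) \<Rightarrow> real" where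
  "max_gap r x = (MAX j\<in>{0..r}. \<bar>ext_points r x (j + 1) - ext_points r x j\<bar>)"

definition euclid_norm :: "real vec \<Rightarrow> real" where
  "euclid_norm v = sqrt (v \<bullet> v)"

definition op_norm :: "real mat \<Rightarrow> real" where
  "op_norm A = Sup {euclid_norm (A *\<^sub>v v) | v. v \<in> carrier_vec (dim_col A) \<and> euclid_norm v \<le> 1}"

(* "mat_inverse A" is "Some" of the two-sided inverse if A is invertible and None otherwise, so
   "mat_inv A" is only meaningful together with "invertible_mat A". *)
definition mat_inv :: "real mat \<Rightarrow> real mat" where
  "mat_inv A = the (mat_inverse A)"

definition cond_number :: "real mat \<Rightarrow> real" where
  "cond_number A = op_norm A * op_norm (mat_inv A)"

end

theory Submission
  imports "HOL-Analysis.Henstock_Kurzweil_Integration" "Jordan_Normal_Form.Determinant" Defs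
begin

unbundle no inner_syntax and no vec_syntax

text \<open>
  The condition number bound compares the discrete norm \<open>\<Sum>j. w\<^sub>j p(x\<^sub>j)\<^sup>2 = c\<^sup>T A c\<close> with
  \<open>\<integral> p\<^sup>2 = (\<Sum>k. c\<^sub>k\<^sup>2) / 2\<close> on \<open>[0, 1]\<close>. The weight \<open>w\<^sub>j\<close> is the length of the cell around \<open>x\<^sub>j\<close>
  bounded by the midpoints of consecutive points. On each half cell, of length at most \<open>\<delta> / 2\<close>, the
  sharp Wirtinger inequality bounds the \<open>L\<^sup>2\<close> distance of \<open>p\<close> from \<open>p(x\<^sub>j)\<close> by \<open>\<delta> / \<pi>\<close> times the norm of
  \<open>p'\<close>, and Parseval's identity bounds the latter by \<open>\<pi> M\<close> times the norm of \<open>p\<close>. Hence the quadratic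
  form of \<open>A\<close> lies between \<open>(1 - \<delta> M)\<^sup>2 / 2\<close> and \<open>(1 + \<delta> M)\<^sup>2 / 2\<close> times the squared norm of \<open>c\<close>.
  Invertibility for \<open>M < r\<close> holds since a cosine polynomial is an algebraic polynomial of degree at
  most \<open>M\<close> in \<open>cos (\<pi> x)\<close>, which is injective on \<open>[0, 1]\<close>.
\<close>

section \<open>Wirtinger inequalities and point evaluation\<close>

text \<open>Since \<open>q = cot \<circ> \<theta>\<close> solves the Riccati equation
  \<open>q' = - \<beta> * (1 + q\<^sup>2)\<close>, the integrand
  \<open>(f' x)\<^sup>2 - \<beta>\<^sup>2 * (f x)\<^sup>2\<close> is the exact derivative
  \<open>G' x\<close> plus a perfect square. The strict bound on \<open>\<beta>\<close> keeps the
  phase \<open>\<theta>\<close> in the interval from 0 (exclusive) to \<open>pi / 2\<close>, away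
  from the poles of the cotangent.\<close>

lemma wirtinger_left_strict:
  fixes f f' :: "real \<Rightarrow> real"
  assumes ab: "a \<le> b" and \<beta>: "0 < \<beta>" "\<beta> * (b - a) < pi / 2"
    and der: "\<And>x. x \<in> {a..b} \<Longrightarrow> (f has_real_derivative f' x) (at x)"
    and cont: "continuous_on {a..b} f'" and fa: "f a = 0"
  shows "\<beta>\<^sup>2 * integral {a..b} (\<lambda>x. (f x)\<^sup>2) \<le> integral {a..b} (\<lambda>x. (f' x)\<^sup>2)"
proof -
  define \<theta> where "\<theta> x = \<beta> * (x - a) + (pi / 2 - \<beta> * (b - a))" for x
  \<comment> \<open>The phase makes the cotangent finite at \<open>a\<close> and zero at \<open>b\<close>, so both boundary terms vanish.\<close>
  define G where "G x = \<beta> * (f x)\<^sup>2 * cot (\<theta> x)" for x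
  define G' where "G' x = 2 * \<beta> * f x * f' x * cot (\<theta> x) - \<beta>\<^sup>2 * (f x)\<^sup>2 * (1 + (cot (\<theta> x))\<^sup>2)" for x
  have sin_pos: "sin (\<theta> x) > 0" if "x \<in> {a..b}" for x
  proof (rule sin_gt_zero)
    have "0 \<le> \<beta> * (x - a)" "\<beta> * (x - a) \<le> \<beta> * (b - a)"
      using that \<beta>(1) by (auto intro!: mult_left_mono)
    then show "0 < \<theta> x" "\<theta> x < pi"
      using \<beta>(2) pi_gt_zero unfolding \<theta>_def by linarith+
  qed
  have "(G has_real_derivative G' x) (at x)" if x: "x \<in> {a..b}" for x
  proof -
    have "(\<theta> has_real_derivative \<beta>) (at x)"
      unfolding \<theta>_def by (auto intro!: derivative_eq_intros)
    then have cot: "((\<lambda>x. cot (\<theta> x)) has_real_derivative - inverse ((sin (\<theta> x))\<^sup>2) * \<beta>) (at x)"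
      using sin_pos[OF x] by (intro DERIV_chain2[OF DERIV_cot]) auto
    have "inverse ((sin (\<theta> x))\<^sup>2) = 1 + (cot (\<theta> x))\<^sup>2"
      using sin_pos[OF x] by (simp add: cot_def field_simps power_divide)
    then show ?thesis
      unfolding G_def G'_def
      by (auto intro!: derivative_eq_intros der[OF x] cot simp: power2_eq_square algebra_simps)
  qed
  then have "(G' has_integral (G b - G a)) {a..b}"
    using ab by (intro fundamental_theorem_of_calculus)
      (auto simp: has_real_derivative_iff_has_vector_derivative intro: has_vector_derivative_at_within)
  moreover have "G a = 0" "G b = 0"
    by (auto simp: G_def \<theta>_def fa cot_def)
  ultimately have G': "(G' has_integral 0) {a..b}"
    by simp
  have contf: "continuous_on {a..b} f"
    using der by (meson DERIV_continuous continuous_at_imp_continuous_on)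
  have int: "(\<lambda>x. (f x)\<^sup>2) integrable_on {a..b}" "(\<lambda>x. (f' x)\<^sup>2) integrable_on {a..b}"
    using contf cont by (auto intro!: integrable_continuous_real continuous_intros)
  have "0 \<le> integral {a..b} (\<lambda>x. (f' x)\<^sup>2) - \<beta>\<^sup>2 * integral {a..b} (\<lambda>x. (f x)\<^sup>2)"
  proof (rule has_integral_le[OF G'])
    show "((\<lambda>x. (f' x)\<^sup>2 - \<beta>\<^sup>2 * (f x)\<^sup>2) has_integral
        (integral {a..b} (\<lambda>x. (f' x)\<^sup>2) - \<beta>\<^sup>2 * integral {a..b} (\<lambda>x. (f x)\<^sup>2))) {a..b}"
      using int by (intro has_integral_diff has_integral_mult_right) (auto intro: integrable_integral)
    have "(f' x)\<^sup>2 - \<beta>\<^sup>2 * (f x)\<^sup>2 - G' x = (f' x - \<beta> * f x * cot (\<theta> x))\<^sup>2" for x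
      unfolding G'_def by (simp add: power2_eq_square algebra_simps)
    then show "G' x \<le> (f' x)\<^sup>2 - \<beta>\<^sup>2 * (f x)\<^sup>2" for x
      by (metis diff_ge_0_iff_ge zero_le_power2)
  qed
  then show ?thesis by simp
qed

text \<open>Limit of the strict case: \<open>\<beta>\<close> approaches the critical frequency
  \<open>pi / (2 * L)\<close>, and the square root in its definition makes \<open>z\<close> enter
  linearly. As \<open>L\<close> may exceed \<open>b - a\<close>, intervals of different lengths can
  share one constant.\<close>

lemma wirtinger_left:
  fixes f f' :: "real \<Rightarrow> real"
  assumes ab: "a \<le> b" and L: "0 < L" "b - a \<le> L"
    and der: "\<And>x. x \<in> {a..b} \<Longrightarrow> (f has_real_derivative f' x) (at x)"
    and cont: "continuous_on {a..b} f'" and fa: "f a = 0"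
  shows "(pi / (2 * L))\<^sup>2 * integral {a..b} (\<lambda>x. (f x)\<^sup>2) \<le> integral {a..b} (\<lambda>x. (f' x)\<^sup>2)"
proof (rule field_le_mult_one_interval)
  fix z :: real
  assume z: "0 < z" "z < 1"
  define \<beta> where "\<beta> = sqrt z * (pi / (2 * L))"
  have "\<beta> > 0" using z L by (simp add: \<beta>_def)
  have "\<beta> * (b - a) \<le> \<beta> * L"
    using \<open>\<beta> > 0\<close> L by (intro mult_left_mono) auto
  also have "\<dots> = sqrt z * (pi / 2)"
    using L by (simp add: \<beta>_def)
  also have "\<dots> < pi / 2"
    using z by simp
  finally have "\<beta>\<^sup>2 * integral {a..b} (\<lambda>x. (f x)\<^sup>2) \<le> integral {a..b} (\<lambda>x. (f' x)\<^sup>2)"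
    using \<open>\<beta> > 0\<close> assms by (intro wirtinger_left_strict) auto
  moreover have "\<beta>\<^sup>2 = z * (pi / (2 * L))\<^sup>2"
    using z by (simp add: \<beta>_def power_mult_distrib power_divide)
  ultimately show "z * ((pi / (2 * L))\<^sup>2 * integral {a..b} (\<lambda>x. (f x)\<^sup>2))
      \<le> integral {a..b} (\<lambda>x. (f' x)\<^sup>2)"
    by (simp add: mult.assoc)
qed

text \<open>The reflection at 0 exchanges the two endpoints and preserves both integrals.\<close>

lemma wirtinger_right:
  fixes f f' :: "real \<Rightarrow> real"
  assumes ab: "a \<le> b" and L: "0 < L" "b - a \<le> L"
    and der: "\<And>x. x \<in> {a..b} \<Longrightarrow> (f has_real_derivative f' x) (at x)"
    and cont: "continuous_on {a..b} f'" and fb: "f b = 0"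
  shows "(pi / (2 * L))\<^sup>2 * integral {a..b} (\<lambda>x. (f x)\<^sup>2) \<le> integral {a..b} (\<lambda>x. (f' x)\<^sup>2)"
proof -
  have "(pi / (2 * L))\<^sup>2 * integral {-b..-a} (\<lambda>x. (f (- x))\<^sup>2)
      \<le> integral {-b..-a} (\<lambda>x. (- f' (- x))\<^sup>2)"
  proof (rule wirtinger_left)
    show "((\<lambda>x. f (- x)) has_real_derivative - f' (- x)) (at x)" if "x \<in> {-b..-a}" for x
    proof -
      have "(f has_real_derivative f' (- x)) (at (- x))"
        using that by (intro der) auto
      then show ?thesis
        by (simp add: DERIV_mirror)
    qed
    show "continuous_on {-b..-a} (\<lambda>x. - f' (- x))"
      by (intro continuous_intros continuous_on_compose2[OF cont]) auto
  qed (use assms in auto)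
  then show ?thesis
    by (simp add: integral_reflect_real[of b a "\<lambda>x. (f x)\<^sup>2"] integral_reflect_real[of b a "\<lambda>x. (f' x)\<^sup>2"])
qed

text \<open>The function \<open>f - f c\<close> vanishes at \<open>c\<close> and has derivative
  \<open>f'\<close>, so each side of \<open>c\<close> is covered by a one-sided version. The common
  \<open>L\<close> allows the two inequalities to be added.\<close>

lemma wirtinger_interior_point:
  fixes f f' :: "real \<Rightarrow> real"
  assumes c: "a \<le> c" "c \<le> b" and L: "0 < L" "c - a \<le> L" "b - c \<le> L"
    and der: "\<And>x. x \<in> {a..b} \<Longrightarrow> (f has_real_derivative f' x) (at x)"
    and cont: "continuous_on {a..b} f'"
  shows "(pi / (2 * L))\<^sup>2 * integral {a..b} (\<lambda>x. (f x - f c)\<^sup>2) \<le> integral {a..b} (\<lambda>x. (f' x)\<^sup>2)"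
proof -
  have contf: "continuous_on {a..b} f"
    using der by (meson DERIV_continuous continuous_at_imp_continuous_on)
  have left: "(pi / (2 * L))\<^sup>2 * integral {a..c} (\<lambda>x. (f x - f c)\<^sup>2) \<le> integral {a..c} (\<lambda>x. (f' x)\<^sup>2)"
    using c L by (intro wirtinger_right)
      (auto intro!: derivative_eq_intros der continuous_on_subset[OF cont])
  have right: "(pi / (2 * L))\<^sup>2 * integral {c..b} (\<lambda>x. (f x - f c)\<^sup>2) \<le> integral {c..b} (\<lambda>x. (f' x)\<^sup>2)"
    using c L by (intro wirtinger_left)
      (auto intro!: derivative_eq_intros der continuous_on_subset[OF cont])
  have "integral {a..c} (\<lambda>x. (f x - f c)\<^sup>2) + integral {c..b} (\<lambda>x. (f x - f c)\<^sup>2)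
      = integral {a..b} (\<lambda>x. (f x - f c)\<^sup>2)"
    using c contf by (intro integral_combine) (auto intro!: integrable_continuous_real continuous_intros)
  moreover have "integral {a..c} (\<lambda>x. (f' x)\<^sup>2) + integral {c..b} (\<lambda>x. (f' x)\<^sup>2)
      = integral {a..b} (\<lambda>x. (f' x)\<^sup>2)"
    using c cont by (intro integral_combine) (auto intro!: integrable_continuous_real continuous_intros)
  ultimately show ?thesis
    using add_mono[OF left right] by (simp add: distrib_left[symmetric])
qed

section \<open>Comparison of weighted sums of samples with integrals\<close>

text \<open>The conjunct \<open>y 0 \<le> y r\<close> is carried through the induction because
  joining the integrals over adjacent intervals requires it.\<close>

lemma integral_partition:
  fixes f :: "real \<Rightarrow> real" and y :: "nat \<Rightarrow> real"
  assumes "\<And>j. j \<in> {1..r} \<Longrightarrow> y (j - 1) \<le> y j" and "continuous_on UNIV f"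
  shows "(\<Sum>j=1..r. integral {y (j - 1)..y j} f) = integral {y 0..y r} f \<and> y 0 \<le> y r"
  using assms(1)
proof (induction r)
  case (Suc r)
  have IH: "(\<Sum>j=1..r. integral {y (j - 1)..y j} f) = integral {y 0..y r} f" "y 0 \<le> y r"
    using Suc by auto
  have le: "y r \<le> y (Suc r)"
    using Suc.prems[of "Suc r"] by simp
  have "integral {y 0..y r} f + integral {y r..y (Suc r)} f = integral {y 0..y (Suc r)} f"
    using IH(2) le continuous_on_subset[OF assms(2)]
    by (intro integral_combine integrable_continuous_real) auto
  then show ?case using IH le by simp
qed simp

text \<open>On each cell the Wirtinger inequality measures the distance of \<open>p\<close> from its
  sample; summed over the cells and combined with \<open>bernstein\<close> it gives
  \<open>E \<le> t\<^sup>2 * P\<close>. Thus \<open>t\<close>, the ratio of \<open>B\<close> to the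
  Wirtinger constant \<open>pi / (2 * L)\<close>, bounds the relative error in the L2 norm, and the
  factors are those of the triangle inequality.\<close>

lemma point_evaluation_sandwich:
  fixes p p' :: "real \<Rightarrow> real" and x y :: "nat \<Rightarrow> real"
  assumes der: "\<And>u. (p has_real_derivative p' u) (at u)" and cont: "continuous_on UNIV p'"
    and cell: "\<And>j. j \<in> {1..r} \<Longrightarrow> y (j - 1) \<le> x j \<and> x j \<le> y j \<and> x j - y (j - 1) \<le> L \<and> y j - x j \<le> L"
    and "0 < L" "0 < B"
    and bernstein: "integral {y 0..y r} (\<lambda>u. (p' u)\<^sup>2) \<le> B\<^sup>2 * integral {y 0..y r} (\<lambda>u. (p u)\<^sup>2)"
  defines "t \<equiv> 2 * L * B / pi"
  defines "S \<equiv> \<Sum>j=1..r. (y j - y (j - 1)) * (p (x j))\<^sup>2"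
    and "P \<equiv> integral {y 0..y r} (\<lambda>u. (p u)\<^sup>2)"
  shows "S \<le> (1 + t)\<^sup>2 * P" and "t \<le> 1 \<Longrightarrow> (1 - t)\<^sup>2 * P \<le> S"
proof -
  define E where "E = (\<Sum>j=1..r. integral {y (j - 1)..y j} (\<lambda>u. (p u - p (x j))\<^sup>2))"
  have t: "t > 0" using \<open>0 < L\<close> \<open>0 < B\<close> by (simp add: t_def)
  have mono: "y (j - 1) \<le> y j" if "j \<in> {1..r}" for j
    using cell[OF that] by linarith
  have contp: "continuous_on A p" "continuous_on A p'" for A
    using DERIV_isCont[OF der] continuous_on_subset[OF cont]
    by (auto intro: continuous_at_imp_continuous_on)
  have parts: "(\<Sum>j=1..r. integral {y (j - 1)..y j} g) = integral {y 0..y r} g"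
    if "continuous_on UNIV g" for g :: "real \<Rightarrow> real"
    using integral_partition[of r y g] mono that by simp
  have P: "(\<Sum>j=1..r. integral {y (j - 1)..y j} (\<lambda>u. (p u)\<^sup>2)) = P"
    unfolding P_def by (intro parts continuous_intros contp)
  have "(pi / (2 * L))\<^sup>2 * E
      \<le> (\<Sum>j=1..r. integral {y (j - 1)..y j} (\<lambda>u. (p' u)\<^sup>2))"
    unfolding E_def sum_distrib_left
  proof (rule sum_mono)
    fix j assume "j \<in> {1..r}"
    then show "(pi / (2 * L))\<^sup>2 * integral {y (j - 1)..y j} (\<lambda>u. (p u - p (x j))\<^sup>2)
        \<le> integral {y (j - 1)..y j} (\<lambda>u. (p' u)\<^sup>2)"
      using cell[of j] \<open>0 < L\<close> by (intro wirtinger_interior_point der contp) auto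
  qed
  also have "\<dots> = integral {y 0..y r} (\<lambda>u. (p' u)\<^sup>2)"
    by (intro parts continuous_intros contp)
  also have "\<dots> \<le> B\<^sup>2 * P"
    using bernstein by (simp add: P_def)
  finally have "(2 * L / pi)\<^sup>2 * ((pi / (2 * L))\<^sup>2 * E) \<le> (2 * L / pi)\<^sup>2 * (B\<^sup>2 * P)"
    by (intro mult_left_mono) auto
  then have E: "E \<le> t\<^sup>2 * P"
    using \<open>0 < L\<close> by (simp add: t_def power_mult_distrib power_divide field_simps)
  \<comment> \<open>Free coefficients, since the upper and the lower bound use this identity with
    different ones.\<close>
  have pt: "integral {y (j - 1)..y j} (\<lambda>u. \<alpha> * (p u)\<^sup>2 + \<gamma> * (p u - p (x j))\<^sup>2)
      = \<alpha> * integral {y (j - 1)..y j} (\<lambda>u. (p u)\<^sup>2) + \<gamma> * integral {y (j - 1)..y j} (\<lambda>u. (p u - p (x j))\<^sup>2)"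
    for j and \<alpha> \<gamma> :: real
    by (subst integral_add) (auto intro!: integrable_continuous_real continuous_intros contp)
  have const: "integral {y (j - 1)..y j} (\<lambda>u. (p (x j))\<^sup>2) = (y j - y (j - 1)) * (p (x j))\<^sup>2"
    if "j \<in> {1..r}" for j
    using mono[OF that] by simp
  \<comment> \<open>Weighted Young inequalities with the parameter \<open>t\<close> replace the triangle inequality in \<open>L\<^sup>2\<close>,
    so that no step function has to be integrated.\<close>
  have "S \<le> (\<Sum>j=1..r. (1 + t) * integral {y (j - 1)..y j} (\<lambda>u. (p u)\<^sup>2)
      + (1 + 1 / t) * integral {y (j - 1)..y j} (\<lambda>u. (p u - p (x j))\<^sup>2))"
    unfolding S_def
  proof (rule sum_mono)
    fix j assume j: "j \<in> {1..r}"
    have "(p (x j))\<^sup>2 \<le> (1 + t) * (p u)\<^sup>2 + (1 + 1 / t) * (p u - p (x j))\<^sup>2" for u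
    proof -
      have "(1 + t) * (p u)\<^sup>2 + (1 + 1 / t) * (p u - p (x j))\<^sup>2 - (p (x j))\<^sup>2
          = (t * p u + (p u - p (x j)))\<^sup>2 / t"
        using t by (simp add: power2_eq_square field_simps)
      also have "\<dots> \<ge> 0" using t by simp
      finally show ?thesis by simp
    qed
    then show "(y j - y (j - 1)) * (p (x j))\<^sup>2 \<le> (1 + t) * integral {y (j - 1)..y j} (\<lambda>u. (p u)\<^sup>2)
      + (1 + 1 / t) * integral {y (j - 1)..y j} (\<lambda>u. (p u - p (x j))\<^sup>2)"
      unfolding pt[symmetric] const[OF j, symmetric]
      by (intro integral_le) (auto intro!: integrable_continuous_real continuous_intros contp)
  qed
  also have "\<dots> = (1 + t) * P + (1 + 1 / t) * E"
    by (simp add: sum.distrib sum_distrib_left[symmetric] P[symmetric] E_def)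
  also have "\<dots> \<le> (1 + t) * P + (1 + 1 / t) * (t\<^sup>2 * P)"
    using E t by (intro add_left_mono mult_left_mono) auto
  also have "\<dots> = (1 + t)\<^sup>2 * P"
    using t by (simp add: power2_eq_square field_simps)
  finally show "S \<le> (1 + t)\<^sup>2 * P" .
  assume "t \<le> 1"
  \<comment> \<open>Written with \<open>1 / t - 1\<close>, which is nonnegative by
    \<open>t \<le> 1\<close>, so that the upper bound on \<open>E\<close> gives a lower bound
    here.\<close>
  have "(1 - t)\<^sup>2 * P = (1 - t) * P - (1 / t - 1) * (t\<^sup>2 * P)"
    using t by (simp add: power2_eq_square field_simps)
  also have "\<dots> \<le> (1 - t) * P - (1 / t - 1) * E"
    using E t \<open>t \<le> 1\<close> by (intro diff_left_mono mult_left_mono) auto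
  also have "\<dots> = (1 - t) * P + (1 - 1 / t) * E"
    by (simp add: algebra_simps)
  also have "\<dots> = (\<Sum>j=1..r. (1 - t) * integral {y (j - 1)..y j} (\<lambda>u. (p u)\<^sup>2)
      + (1 - 1 / t) * integral {y (j - 1)..y j} (\<lambda>u. (p u - p (x j))\<^sup>2))"
    by (simp add: sum.distrib sum_distrib_left[symmetric] P[symmetric] E_def)
  also have "\<dots> \<le> S"
    unfolding S_def
  proof (rule sum_mono)
    fix j assume j: "j \<in> {1..r}"
    have "(1 - t) * (p u)\<^sup>2 + (1 - 1 / t) * (p u - p (x j))\<^sup>2 \<le> (p (x j))\<^sup>2" for u
    proof -
      have "(p (x j))\<^sup>2 - ((1 - t) * (p u)\<^sup>2 + (1 - 1 / t) * (p u - p (x j))\<^sup>2)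
          = (t * p u - (p u - p (x j)))\<^sup>2 / t"
        using t by (simp add: power2_eq_square field_simps)
      also have "\<dots> \<ge> 0" using t by simp
      finally show ?thesis by simp
    qed
    then show "(1 - t) * integral {y (j - 1)..y j} (\<lambda>u. (p u)\<^sup>2)
      + (1 - 1 / t) * integral {y (j - 1)..y j} (\<lambda>u. (p u - p (x j))\<^sup>2)
      \<le> (y j - y (j - 1)) * (p (x j))\<^sup>2"
      unfolding pt[symmetric] const[OF j, symmetric]
      by (intro integral_le) (auto intro!: integrable_continuous_real continuous_intros contp)
  qed
  finally show "(1 - t)\<^sup>2 * P \<le> S" .
qed

section \<open>Cosine polynomials\<close>

text \<open>The factor at \<open>k = 0\<close> gives all basis functions the same L2 norm on
  \<open>[0, 1]\<close>.\<close>

definition cos_basis :: "nat \<Rightarrow> real \<Rightarrow> real" where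
  "cos_basis k u = (if k = 0 then 1 / sqrt 2 else cos (pi * real k * u))"

lemma cos_poly_cos_basis: "cos_poly M c u = (\<Sum>k\<le>M. vec_index c k * cos_basis k u)"
proof -
  have "{..M} = insert 0 {1..M}" by auto
  then show ?thesis by (simp add: cos_poly_def cos_basis_def)
qed

lemma cos_basis_has_derivative:
  "(cos_basis k has_real_derivative - (pi * real k) * sin (pi * real k * u)) (at u)"
  unfolding cos_basis_def by (cases "k = 0") (auto intro!: derivative_eq_intros)

section \<open>Orthogonality and Parseval's identity\<close>

text \<open>Integer frequencies are allowed because the product-to-sum formulas produce
  \<open>int k - int l\<close>, which may be negative.\<close>

lemma has_integral_cos_int:
  "((\<lambda>u. cos (pi * of_int m * u)) has_integral (if m = 0 then 1 else 0)) {0..1::real}"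
proof (cases "m = 0")
  case True
  then show ?thesis using has_integral_const_real[of "1::real" 0 1] by simp
next
  case False
  have "((\<lambda>u. cos (pi * of_int m * u)) has_integral
      (sin (pi * of_int m * 1) / (pi * of_int m) - sin (pi * of_int m * 0) / (pi * of_int m))) {0..1::real}"
    using False by (intro fundamental_theorem_of_calculus)
      (auto simp: has_real_derivative_iff_has_vector_derivative[symmetric] intro!: derivative_eq_intros)
  then show ?thesis using False by simp
qed

text \<open>The product is the mean of cosines of frequencies \<open>k - l\<close> and
  \<open>k + l\<close>, and only frequency 0 contributes. The second one contributes only at
  \<open>k = l = 0\<close>.\<close>

lemma has_integral_cos_cos:
  "((\<lambda>u. cos (pi * real k * u) * cos (pi * real l * u)) has_integral
     ((if k = l then 1 else 0) + (if k + l = 0 then 1 else 0)) / 2) {0..1}"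
proof -
  have "((\<lambda>u. (cos (pi * of_int (int k - int l) * u) + cos (pi * of_int (int k + int l) * u)) / 2) has_integral
     ((if int k - int l = 0 then 1 else 0) + (if int k + int l = 0 then 1 else 0)) / 2) {0..1::real}"
    by (intro has_integral_divide has_integral_add has_integral_cos_int)
  moreover have "(cos (pi * of_int (int k - int l) * u) + cos (pi * of_int (int k + int l) * u)) / 2
      = cos (pi * real k * u) * cos (pi * real l * u)" for u
    by (simp add: cos_times_cos algebra_simps)
  ultimately show ?thesis by (simp add: of_nat_add[symmetric] del: of_nat_add)
qed

lemma has_integral_sin_sin:
  "((\<lambda>u. sin (pi * real k * u) * sin (pi * real l * u)) has_integral
     ((if k = l then 1 else 0) - (if k + l = 0 then 1 else 0)) / 2) {0..1}"
proof -
  have "((\<lambda>u. (cos (pi * of_int (int k - int l) * u) - cos (pi * of_int (int k + int l) * u)) / 2) has_integral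
     ((if int k - int l = 0 then 1 else 0) - (if int k + int l = 0 then 1 else 0)) / 2) {0..1::real}"
    by (intro has_integral_divide has_integral_diff has_integral_cos_int)
  moreover have "(cos (pi * of_int (int k - int l) * u) - cos (pi * of_int (int k + int l) * u)) / 2
      = sin (pi * real k * u) * sin (pi * real l * u)" for u
    by (simp add: sin_times_sin algebra_simps)
  ultimately show ?thesis by (simp add: of_nat_add[symmetric] del: of_nat_add)
qed

text \<open>Expanding the square leaves the diagonal terms. The squared norms \<open>N k\<close> may
  depend on \<open>k\<close>, which covers both the cosine system and the sines in the
  derivative.\<close>

lemma has_integral_orthogonal_sum_squared:
  fixes e :: "nat \<Rightarrow> real \<Rightarrow> real" and c N :: "nat \<Rightarrow> real"
  assumes "\<And>k l. ((\<lambda>u. e k u * e l u) has_integral (if k = l then N k else 0)) S"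
  shows "((\<lambda>u. (\<Sum>k\<le>M. c k * e k u)\<^sup>2) has_integral (\<Sum>k\<le>M. (c k)\<^sup>2 * N k)) S"
proof -
  have "((\<lambda>u. \<Sum>k\<le>M. \<Sum>l\<le>M. c k * c l * (e k u * e l u)) has_integral
      (\<Sum>k\<le>M. \<Sum>l\<le>M. c k * c l * (if k = l then N k else 0))) S"
    by (intro has_integral_sum has_integral_mult_right assms) auto
  moreover have "(\<Sum>k\<le>M. \<Sum>l\<le>M. c k * c l * (e k u * e l u)) = (\<Sum>k\<le>M. c k * e k u)\<^sup>2" for u
    by (simp add: power2_eq_square sum_product mult_ac)
  moreover have "(\<Sum>l\<le>M. c k * c l * (if k = l then N k else 0)) = (c k)\<^sup>2 * N k" if "k \<le> M" for k
    using that by (simp add: if_distrib power2_eq_square cong: if_cong)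
  ultimately show ?thesis by simp
qed

lemma has_integral_cos_poly_squared:
  "((\<lambda>u. (cos_poly M c u)\<^sup>2) has_integral (\<Sum>k\<le>M. (vec_index c k)\<^sup>2) / 2) {0..1}"
proof -
  have "((\<lambda>u. cos_basis k u * cos_basis l u) has_integral (if k = l then 1 / 2 else 0)) {0..1}" for k l
  proof -
    \<comment> \<open>At \<open>k = l = 0\<close> the doubled cosine integral 1 is halved by
      \<open>d 0 * d 0 = 1 / 2\<close>, matching the value for the other diagonal entries.\<close>
    define d where "d n = (if n = 0 then 1 / sqrt 2 else (1::real))" for n :: nat
    have "((\<lambda>u. (d k * d l) * (cos (pi * real k * u) * cos (pi * real l * u))) has_integral
        (d k * d l) * (((if k = l then 1 else 0) + (if k + l = 0 then 1 else 0)) / 2)) {0..1}"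
      by (intro has_integral_mult_right has_integral_cos_cos)
    moreover have "cos_basis n u = d n * cos (pi * real n * u)" for n u
      by (simp add: cos_basis_def d_def)
    ultimately show ?thesis
      by (auto simp: d_def mult_ac split: if_splits)
  qed
  from has_integral_orthogonal_sum_squared[OF this, where M = M and c = "vec_index c"] show ?thesis
    by (simp add: cos_poly_cos_basis sum_divide_distrib)
qed

definition cos_poly_deriv :: "nat \<Rightarrow> real Matrix.vec \<Rightarrow> real \<Rightarrow> real" where
  "cos_poly_deriv M c u = (\<Sum>k\<le>M. vec_index c k * (- (pi * real k) * sin (pi * real k * u)))"

lemma cos_poly_has_derivative:
  "(cos_poly M c has_real_derivative cos_poly_deriv M c u) (at u)"
  unfolding cos_poly_cos_basis[abs_def] cos_poly_deriv_def
  by (intro DERIV_sum DERIV_cmult cos_basis_has_derivative)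

text \<open>Differentiation multiplies the mode \<open>k\<close> by at most
  \<open>pi * real M\<close> in absolute value, and Parseval's identity holds for the sines as well
  as for the cosines.\<close>

lemma bernstein_cos_poly:
  "integral {0..1} (\<lambda>u. (cos_poly_deriv M c u)\<^sup>2)
     \<le> (pi * real M)\<^sup>2 * integral {0..1} (\<lambda>u. (cos_poly M c u)\<^sup>2)"
proof -
  have "((\<lambda>u. (- (pi * real k) * sin (pi * real k * u)) * (- (pi * real l) * sin (pi * real l * u)))
      has_integral (if k = l then (pi * real k)\<^sup>2 / 2 else 0)) {0..1}" for k l
  proof -
    have "((\<lambda>u. (pi * real k) * (pi * real l) * (sin (pi * real k * u) * sin (pi * real l * u)))
      has_integral (pi * real k) * (pi * real l) *
        (((if k = l then 1 else 0) - (if k + l = 0 then 1 else 0)) / 2)) {0..1}"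
      by (intro has_integral_mult_right has_integral_sin_sin)
    then show ?thesis by (auto simp: mult_ac power2_eq_square split: if_splits)
  qed
  from has_integral_orthogonal_sum_squared[OF this, where M = M and c = "vec_index c"]
  have "integral {0..1} (\<lambda>u. (cos_poly_deriv M c u)\<^sup>2) = (\<Sum>k\<le>M. (vec_index c k)\<^sup>2 * ((pi * real k)\<^sup>2 / 2))"
    unfolding cos_poly_deriv_def by (rule integral_unique)
  also have "\<dots> \<le> (\<Sum>k\<le>M. (vec_index c k)\<^sup>2 * ((pi * real M)\<^sup>2 / 2))"
    by (intro sum_mono mult_left_mono divide_right_mono power_mono) auto
  also have "\<dots> = (pi * real M)\<^sup>2 * integral {0..1} (\<lambda>u. (cos_poly M c u)\<^sup>2)"
    by (simp add: integral_unique[OF has_integral_cos_poly_squared] sum_distrib_left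
        sum_divide_distrib mult_ac)
  finally show ?thesis .
qed

section \<open>Zeros of cosine polynomials\<close>

text \<open>These are the Chebyshev polynomials, built by the recurrence \<open>cos ((n + 2) * t) =
  2 * cos t * cos ((n + 1) * t) - cos (n * t)\<close>.\<close>

lemma cos_multiple_poly:
  "\<exists>q :: real poly. degree q \<le> k \<and> (\<forall>t. poly q (cos t) = cos (real k * t))"
proof (induction k rule: less_induct)
  case (less k)
  consider "k = 0" | "k = 1" | n where "k = Suc (Suc n)"
    by (metis One_nat_def not0_implies_Suc)
  then show ?case
  proof cases
    case 1
    then show ?thesis by (intro exI[of _ "[:1:]"]) auto
  next
    case 2
    then show ?thesis by (intro exI[of _ "[:0, 1:]"]) auto
  next
    case (3 n)
    obtain q0 q1 :: "real poly" where
      q0: "degree q0 \<le> n" "\<And>t. poly q0 (cos t) = cos (real n * t)" and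
      q1: "degree q1 \<le> Suc n" "\<And>t. poly q1 (cos t) = cos (real (Suc n) * t)"
      using less[of n] less[of "Suc n"] 3 by auto
    have "degree ([:0, 2:] * q1) \<le> k"
      using degree_mult_le[of "[:0, 2:]" q1] q1(1) 3 by simp
    then have "degree ([:0, 2:] * q1 - q0) \<le> k"
      using q0(1) 3 by (intro degree_diff_le) auto
    moreover have "poly ([:0, 2:] * q1 - q0) (cos t) = cos (real k * t)" for t
    proof -
      have "2 * (cos (real (Suc n) * t) * cos t) = cos (real n * t) + cos (real k * t)"
        by (simp add: cos_times_cos 3 algebra_simps)
      then show ?thesis using q0(2) q1(2) by (simp add: algebra_simps)
    qed
    ultimately show ?thesis by blast
  qed
qed

lemma cos_poly_as_poly:
  obtains q :: "real poly" where "degree q \<le> M" "\<And>u. cos_poly M c u = poly q (cos (pi * u))"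
proof -
  obtain T :: "nat \<Rightarrow> real poly" where
    T: "\<And>k. degree (T k) \<le> k" "\<And>k t. poly (T k) (cos t) = cos (real k * t)"
    using cos_multiple_poly by metis
  define q where "q = [:vec_index c 0 / sqrt 2:] + (\<Sum>k=1..M. smult (vec_index c k) (T k))"
  have "degree q \<le> M"
    unfolding q_def
  proof (intro degree_add_le degree_sum_le)
    show "degree (smult (vec_index c k) (T k)) \<le> M" if "k \<in> {1..M}" for k
      using that T(1)[of k] degree_smult_le[of "vec_index c k" "T k"] by simp
  qed auto
  moreover have "cos_poly M c u = poly q (cos (pi * u))" for u
    by (simp add: q_def cos_poly_def poly_sum T(2) mult_ac)
  ultimately show ?thesis using that by blast
qed

text \<open>As \<open>cos\<close> is injective on \<open>{0..pi}\<close>, distinct zeros in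
  \<open>S\<close> become distinct roots of an algebraic polynomial of degree at most
  \<open>M\<close>, which must therefore be 0.\<close>

lemma cos_poly_eq_0_if_many_zeros:
  assumes "S \<subseteq> {0..1}" "M < card S" "\<And>u. u \<in> S \<Longrightarrow> cos_poly M c u = 0"
  shows "cos_poly M c u = 0"
proof -
  obtain q :: "real poly" where
    q: "degree q \<le> M" "\<And>u. cos_poly M c u = poly q (cos (pi * u))"
    using cos_poly_as_poly by blast
  have "inj_on (\<lambda>u. cos (pi * u)) S"
  proof (rule inj_onI)
    fix u v assume uv: "u \<in> S" "v \<in> S" "cos (pi * u) = cos (pi * v)"
    have "0 \<le> pi * u \<and> pi * u \<le> pi" if "u \<in> S" for u
      using that assms(1) mult_left_le[of u pi] by auto
    then have "pi * u = pi * v"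
      using cos_inj_pi[of "pi * u" "pi * v"] uv by blast
    then show "u = v" by simp
  qed
  then have card: "card ((\<lambda>u. cos (pi * u)) ` S) > degree q"
    using assms(2) q(1) by (simp add: card_image)
  have "q = 0"
  proof (rule ccontr)
    assume "q \<noteq> 0"
    then have "card ((\<lambda>u. cos (pi * u)) ` S) \<le> card {z. poly q z = 0}"
      using assms(3) q(2) by (intro card_mono poly_roots_finite) auto
    then show False using card card_poly_roots_bound[OF \<open>q \<noteq> 0\<close>] by simp
  qed
  then show ?thesis using q(2) by simp
qed

text \<open>By Parseval's identity the squares of the coefficients sum to 0.\<close>

lemma cos_poly_eq_0_imp_coeffs:
  assumes "c \<in> carrier_vec (M + 1)" "\<And>u. cos_poly M c u = 0"
  shows "c = 0\<^sub>v (M + 1)"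
proof -
  have "(\<Sum>k\<le>M. (vec_index c k)\<^sup>2) / 2 = 0"
    using has_integral_cos_poly_squared[of M c] by (simp add: assms(2))
  then have "\<forall>k\<le>M. vec_index c k = 0"
    by (simp add: sum_nonneg_eq_0_iff)
  then show ?thesis using assms(1) by (intro eq_vecI) auto
qed

section \<open>Gram matrices\<close>

lemma scalar_prod_self: "v \<bullet> v = (\<Sum>i<dim_vec v. (vec_index v i)\<^sup>2)" for v :: "real Matrix.vec"
  by (simp add: scalar_prod_def power2_eq_square atLeast0LessThan)

lemma scalar_prod_self_nonneg: "0 \<le> v \<bullet> v" for v :: "real Matrix.vec"
  by (simp add: scalar_prod_self sum_nonneg)

lemma scalar_prod_self_eq_0_iff:
  fixes v :: "real Matrix.vec"
  assumes "v \<in> carrier_vec n"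
  shows "v \<bullet> v = 0 \<longleftrightarrow> v = 0\<^sub>v n"
  using assms by (auto simp: scalar_prod_self sum_nonneg_eq_0_iff intro!: eq_vecI)

lemma euclid_norm_nonneg: "0 \<le> euclid_norm v"
  by (simp add: euclid_norm_def scalar_prod_self_nonneg)

lemma euclid_norm_squared: "(euclid_norm v)\<^sup>2 = v \<bullet> v"
  by (simp add: euclid_norm_def scalar_prod_self_nonneg)

lemma scalar_prod_le_euclid_norm:
  assumes "u \<in> carrier_vec n" "v \<in> carrier_vec n"
  shows "u \<bullet> v \<le> euclid_norm u * euclid_norm v"
proof -
  have "(u \<bullet> v)\<^sup>2 \<le> (\<Sum>i<n. (vec_index u i)\<^sup>2) * (\<Sum>i<n. (vec_index v i)\<^sup>2)"
    using assms Cauchy_Schwarz_ineq_sum[of "vec_index u" "vec_index v" "{..<n}"]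
    by (auto simp: scalar_prod_def atLeast0LessThan)
  also have "\<dots> = (euclid_norm u * euclid_norm v)\<^sup>2"
    using assms by (simp add: power_mult_distrib euclid_norm_squared scalar_prod_self)
  finally show ?thesis
    by (rule power2_le_imp_le) (simp add: euclid_norm_nonneg)
qed

section \<open>Operator norm, inverse and condition number\<close>

text \<open>A bound on all vectors makes the set under the supremum bounded, and the zero vector
  makes it nonempty. Nonnegativity is recorded for multiplying norm bounds in
  \<open>cond_number\<close>.\<close>

lemma op_norm_bounds:
  assumes A: "A \<in> carrier_mat m n" and "0 \<le> K"
    and bound: "\<And>v. v \<in> carrier_vec n \<Longrightarrow> euclid_norm (A *\<^sub>v v) \<le> K * euclid_norm v"
  shows "0 \<le> op_norm A" "op_norm A \<le> K"
proof -
  let ?X = "{euclid_norm (A *\<^sub>v v) | v. v \<in> carrier_vec (dim_col A) \<and> euclid_norm v \<le> 1}"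
  have le: "z \<le> K" if z: "z \<in> ?X" for z
  proof -
    obtain v where v: "v \<in> carrier_vec n" "euclid_norm v \<le> 1" "z = euclid_norm (A *\<^sub>v v)"
      using z A by auto
    have "z \<le> K * euclid_norm v" using bound v by simp
    also have "\<dots> \<le> K" using v(2) \<open>0 \<le> K\<close> by (simp add: mult_left_le)
    finally show ?thesis .
  qed
  have "euclid_norm (A *\<^sub>v 0\<^sub>v n) \<in> ?X"
    using A by (intro CollectI exI[of _ "0\<^sub>v n"]) (auto simp: euclid_norm_def)
  moreover from this have "euclid_norm (A *\<^sub>v 0\<^sub>v n) \<le> op_norm A"
    unfolding op_norm_def by (rule cSup_upper) (use le in \<open>auto intro!: bdd_aboveI\<close>)
  ultimately show "0 \<le> op_norm A" "op_norm A \<le> K"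
    unfolding op_norm_def using le euclid_norm_nonneg[of "A *\<^sub>v 0\<^sub>v n"]
    by (auto intro!: cSup_least intro: order_trans)
qed

text \<open>A trivial kernel gives a nonzero determinant, hence a unit of the matrix ring, so that
  \<open>mat_inverse\<close> returns \<open>Some\<close> and \<open>mat_inv\<close> is a genuine
  inverse.\<close>

lemma mat_inv_if_trivial_kernel:
  assumes A: "A \<in> carrier_mat n n"
    and ker: "\<And>v. v \<in> carrier_vec n \<Longrightarrow> A *\<^sub>v v = 0\<^sub>v n \<Longrightarrow> v = 0\<^sub>v n"
  shows "invertible_mat A" "mat_inv A \<in> carrier_mat n n"
    "A * mat_inv A = 1\<^sub>m n" "mat_inv A * A = 1\<^sub>m n"
proof -
  have "det A \<noteq> 0"
    using det_0_iff_vec_prod_zero[OF A] ker by blast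
  then have "A \<in> Units (ring_mat TYPE(real) n ())"
    by (rule det_non_zero_imp_unit[OF A])
  then obtain B where "mat_inverse A = Some B"
    using mat_inverse(1)[OF A, where b = "()"] by (cases "mat_inverse A") auto
  then show *: "mat_inv A \<in> carrier_mat n n" "A * mat_inv A = 1\<^sub>m n" "mat_inv A * A = 1\<^sub>m n"
    using mat_inverse(2)[OF A] by (auto simp: mat_inv_def)
  then show "invertible_mat A"
    using A unfolding invertible_mat_def inverts_mat_def by auto
qed

lemma gram_scalar_prod:
  fixes V :: "real mat"
  assumes V: "V \<in> carrier_mat r n" and "u \<in> carrier_vec n" "v \<in> carrier_vec n"
  shows "((transpose_mat V * V) *\<^sub>v u) \<bullet> v = (V *\<^sub>v u) \<bullet> (V *\<^sub>v v)"
  using assms transpose_vec_mult_scalar[OF V assms(3), of "V *\<^sub>v u"]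
  by (simp add: assoc_mult_mat_vec[of _ n r V n])

text \<open>Pairing the equation with \<open>v\<close> shows that \<open>V *\<^sub>v v\<close> has
  norm 0.\<close>

lemma gram_trivial_kernel:
  fixes V :: "real mat"
  assumes V: "V \<in> carrier_mat r n"
    and ker: "\<And>v. v \<in> carrier_vec n \<Longrightarrow> V *\<^sub>v v = 0\<^sub>v r \<Longrightarrow> v = 0\<^sub>v n"
    and v: "v \<in> carrier_vec n" and "(transpose_mat V * V) *\<^sub>v v = 0\<^sub>v n"
  shows "v = 0\<^sub>v n"
proof -
  have "(V *\<^sub>v v) \<bullet> (V *\<^sub>v v) = 0"
    using gram_scalar_prod[OF V v v] assms(4) v by simp
  then have "V *\<^sub>v v = 0\<^sub>v r"
    using V v by (subst (asm) scalar_prod_self_eq_0_iff[of _ r]) auto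
  then show ?thesis using ker v by blast
qed

text \<open>Bounds on the quadratic form give \<open>K\<close> for the norm of \<open>A\<close> and
  \<open>1 / m\<close> for that of its inverse. Both follow from Cauchy-Schwarz, without
  eigenvalues.\<close>

lemma cond_number_gram_le:
  fixes V :: "real mat"
  assumes V: "V \<in> carrier_mat r n" and "0 < m" "0 \<le> K"
    and lower: "\<And>v. v \<in> carrier_vec n \<Longrightarrow> m * (v \<bullet> v) \<le> (V *\<^sub>v v) \<bullet> (V *\<^sub>v v)"
    and upper: "\<And>v. v \<in> carrier_vec n \<Longrightarrow> (V *\<^sub>v v) \<bullet> (V *\<^sub>v v) \<le> K * (v \<bullet> v)"
  defines "A \<equiv> transpose_mat V * V"
  shows "invertible_mat A" "cond_number A \<le> K / m"
proof -
  have A: "A \<in> carrier_mat n n" using V by (simp add: A_def)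
  have ker: "v = 0\<^sub>v n" if "v \<in> carrier_vec n" "V *\<^sub>v v = 0\<^sub>v r" for v
  proof -
    have "m * (v \<bullet> v) \<le> 0" using lower[OF that(1)] that(2) by simp
    then have "v \<bullet> v = 0"
      using \<open>0 < m\<close> scalar_prod_self_nonneg[of v] by (simp add: mult_le_0_iff)
    then show ?thesis using that(1) scalar_prod_self_eq_0_iff by blast
  qed
  have "v = 0\<^sub>v n" if "v \<in> carrier_vec n" "A *\<^sub>v v = 0\<^sub>v n" for v
    using gram_trivial_kernel[OF V _ that[unfolded A_def]] ker by blast
  note inv = mat_inv_if_trivial_kernel[OF A this]
  show "invertible_mat A" by (rule inv(1))
  have upper': "euclid_norm (V *\<^sub>v v) \<le> sqrt K * euclid_norm v" if "v \<in> carrier_vec n" for v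
    unfolding euclid_norm_def real_sqrt_mult[symmetric] using upper[OF that] by simp
  have "euclid_norm (A *\<^sub>v v) \<le> K * euclid_norm v" if v: "v \<in> carrier_vec n" for v
  proof -
    have Av: "A *\<^sub>v v \<in> carrier_vec n" using A v by simp
    \<comment> \<open>Pairing \<open>A *\<^sub>v v\<close> with itself moves one factor
      \<open>V\<close> to the other side; each remaining factor costs \<open>sqrt K\<close>, and one
      norm of \<open>A *\<^sub>v v\<close> cancels at the end.\<close>
    have "euclid_norm (A *\<^sub>v v) * euclid_norm (A *\<^sub>v v) = (V *\<^sub>v v) \<bullet> (V *\<^sub>v (A *\<^sub>v v))"
      using gram_scalar_prod[OF V v Av]
      by (simp add: A_def power2_eq_square[symmetric] euclid_norm_squared)
    also have "\<dots> \<le> euclid_norm (V *\<^sub>v v) * euclid_norm (V *\<^sub>v (A *\<^sub>v v))"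
      using V v Av by (intro scalar_prod_le_euclid_norm[of _ r]) auto
    also have "\<dots> \<le> (sqrt K * euclid_norm v) * (sqrt K * euclid_norm (A *\<^sub>v v))"
      using upper' v Av euclid_norm_nonneg \<open>0 \<le> K\<close> by (intro mult_mono) auto
    also have "\<dots> = (K * euclid_norm v) * euclid_norm (A *\<^sub>v v)"
      using \<open>0 \<le> K\<close> by (simp add: algebra_simps)
    finally show ?thesis
      using euclid_norm_nonneg[of "A *\<^sub>v v"] euclid_norm_nonneg[of v] \<open>0 \<le> K\<close>
      by (cases "euclid_norm (A *\<^sub>v v) = 0") (auto simp: mult_le_cancel_right)
  qed
  note opA = op_norm_bounds[OF A \<open>0 \<le> K\<close> this]
  have "euclid_norm (mat_inv A *\<^sub>v u) \<le> 1 / m * euclid_norm u" if u: "u \<in> carrier_vec n" for u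
  proof -
    define v where "v = mat_inv A *\<^sub>v u"
    have v: "v \<in> carrier_vec n" using inv(2) u by (simp add: v_def)
    have Av: "A *\<^sub>v v = u"
      using assoc_mult_mat_vec[OF A inv(2) u] inv(3) u by (simp add: v_def)
    \<comment> \<open>Coercivity at the preimage \<open>v\<close> of \<open>u\<close>; one norm of
      \<open>v\<close> cancels afterwards unless it is 0.\<close>
    have "m * euclid_norm v * euclid_norm v = m * (v \<bullet> v)"
      by (simp add: mult.assoc power2_eq_square[symmetric] euclid_norm_squared)
    also have "\<dots> \<le> u \<bullet> v"
      using lower[OF v] gram_scalar_prod[OF V v v] Av by (simp add: A_def)
    also have "\<dots> \<le> euclid_norm u * euclid_norm v"
      by (rule scalar_prod_le_euclid_norm[OF u v])
    finally have "m * euclid_norm v \<le> euclid_norm u"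
      using euclid_norm_nonneg[of v] euclid_norm_nonneg[of u]
      by (cases "euclid_norm v = 0") (auto simp: mult_le_cancel_right)
    then show ?thesis using \<open>0 < m\<close> by (simp add: v_def field_simps)
  qed
  then have opI: "0 \<le> op_norm (mat_inv A)" "op_norm (mat_inv A) \<le> 1 / m"
    using op_norm_bounds[OF inv(2), of "1 / m"] \<open>0 < m\<close> by auto
  have "cond_number A \<le> K * (1 / m)"
    unfolding cond_number_def using opA opI \<open>0 \<le> K\<close> by (intro mult_mono) auto
  then show "cond_number A \<le> K / m" by simp
qed

section \<open>Normal equations\<close>

text \<open>The normal equations say that the residual at \<open>c0\<close> is orthogonal to the
  range of \<open>V\<close>, so the mixed terms vanish.\<close>

lemma least_squares_pythagoras:
  fixes V :: "real mat"
  assumes V: "V \<in> carrier_mat r n" and b: "b \<in> carrier_vec r"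
    and c0: "c0 \<in> carrier_vec n" and c: "c \<in> carrier_vec n"
    and normal: "(transpose_mat V * V) *\<^sub>v c0 = transpose_mat V *\<^sub>v b"
  shows "(V *\<^sub>v c - b) \<bullet> (V *\<^sub>v c - b)
    = (V *\<^sub>v c0 - b) \<bullet> (V *\<^sub>v c0 - b) + (V *\<^sub>v (c - c0)) \<bullet> (V *\<^sub>v (c - c0))"
proof -
  define d where "d = V *\<^sub>v (c - c0)"
  define e where "e = V *\<^sub>v c0 - b"
  have de: "d \<in> carrier_vec r" "e \<in> carrier_vec r"
    using assms by (auto simp: d_def e_def)
  have cc: "c - c0 \<in> carrier_vec n" using c c0 by simp
  have "(V *\<^sub>v c0) \<bullet> d = b \<bullet> d"
    using gram_scalar_prod[OF V c0 cc] transpose_vec_mult_scalar[OF V cc b] normal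
    by (simp add: d_def)
  moreover have "e \<bullet> d = (V *\<^sub>v c0) \<bullet> d - b \<bullet> d"
    unfolding e_def using V c0 b de by (intro minus_scalar_prod_distrib[of _ r]) auto
  ultimately have ed: "e \<bullet> d = 0" by simp
  have "V *\<^sub>v c - b = e + d"
    using assms by (auto simp: e_def d_def mult_minus_distrib_mat_vec[OF V c c0])
  then have "(V *\<^sub>v c - b) \<bullet> (V *\<^sub>v c - b) = e \<bullet> e + e \<bullet> d + (d \<bullet> e + d \<bullet> d)"
    using de by (simp add: add_scalar_prod_distrib[of _ r] scalar_prod_add_distrib[of _ r])
  then show ?thesis
    using ed comm_scalar_prod[OF de] by (simp add: e_def d_def)
qed

section \<open>Trigonometric least squares\<close>

lemma sampling_mat_carrier: "sampling_mat M r x w \<in> carrier_mat r (M + 1)"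
  by (simp add: sampling_mat_def)

lemma sampling_mat_index:
  assumes "i < r" "k \<le> M"
  shows "sampling_mat M r x w $$ (i, k) = sqrt (w (Suc i)) * cos_basis k (x (Suc i))"
  using assms by (simp add: sampling_mat_def cos_basis_def)

lemma sampling_mat_mult_vec:
  assumes "c \<in> carrier_vec (M + 1)"
  shows "sampling_mat M r x w *\<^sub>v c = vec r (\<lambda>i. sqrt (w (Suc i)) * cos_poly M c (x (Suc i)))"
proof (rule eq_vecI)
  fix i assume i: "i < dim_vec (vec r (\<lambda>i. sqrt (w (Suc i)) * cos_poly M c (x (Suc i))))"
  then have "(sampling_mat M r x w *\<^sub>v c) $ i
      = (\<Sum>k\<le>M. sampling_mat M r x w $$ (i, k) * vec_index c k)"
    using sampling_mat_carrier[of M r x w] assms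
    by (auto simp: scalar_prod_def atLeast0LessThan lessThan_Suc_atMost intro!: sum.cong)
  also have "\<dots> = sqrt (w (Suc i)) * cos_poly M c (x (Suc i))"
    using i by (auto simp: sampling_mat_index cos_poly_cos_basis sum_distrib_left intro!: sum.cong)
  finally show "(sampling_mat M r x w *\<^sub>v c) $ i
      = vec r (\<lambda>i. sqrt (w (Suc i)) * cos_poly M c (x (Suc i))) $ i"
    using i by simp
qed (simp add: sampling_mat_def)

lemma sampling_mat_quadratic_form:
  assumes "c \<in> carrier_vec (M + 1)" "\<And>j. j \<in> {1..r} \<Longrightarrow> 0 \<le> w j"
  shows "(sampling_mat M r x w *\<^sub>v c) \<bullet> (sampling_mat M r x w *\<^sub>v c)
    = (\<Sum>j=1..r. w j * (cos_poly M c (x j))\<^sup>2)"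
  using assms unfolding sampling_mat_mult_vec[OF assms(1)] One_nat_def sum.atLeast1_atMost_eq
  by (auto simp: scalar_prod_self power_mult_distrib intro!: sum.cong)

lemma lsq_error_cos_poly:
  fixes x s w :: "nat \<Rightarrow> real"
  assumes "c \<in> carrier_vec (M + 1)" "\<And>j. j \<in> {1..r} \<Longrightarrow> 0 \<le> w j"
  defines "d \<equiv> sampling_mat M r x w *\<^sub>v c - weighted_samples r w s"
  shows "lsq_error r x w s (cos_poly M c) = d \<bullet> d"
  using assms(2) unfolding d_def sampling_mat_mult_vec[OF assms(1)] lsq_error_def
    weighted_samples_def One_nat_def sum.atLeast1_atMost_eq
  by (auto simp: scalar_prod_self right_diff_distrib[symmetric] power_mult_distrib intro!: sum.cong)

text \<open>Each product of cosines splits into a difference frequency, giving the Toeplitz part,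
  and a sum frequency, giving the Hankel part. The \<open>1 / 2\<close> of this formula sits in
  \<open>cos_moment\<close>, the normalisation of the constant term in
  \<open>scale_mat\<close>.\<close>

lemma gram_mat_toeplitz_hankel:
  assumes w: "\<And>j. j \<in> {1..r} \<Longrightarrow> 0 \<le> w j"
  shows "gram_mat M r x w =
    scale_mat M * (toeplitz_mat M (cos_moment r x w) + hankel_mat M (cos_moment r x w)) * scale_mat M"
    (is "_ = ?R")
proof (rule eq_matI)
  define d where "d k = (if k = 0 then 1 / sqrt 2 else (1::real))" for k :: nat
  have R: "?R = mat (M + 1) (M + 1) (\<lambda>(k, l).
      d k * (cos_moment r x w (nat \<bar>int k - int l\<bar>) + cos_moment r x w (k + l)) * d l)"
    unfolding scale_mat_def
    by (subst mat_diag_mult_left[of _ _ "M + 1"], simp add: toeplitz_mat_def hankel_mat_def,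
        subst mat_diag_mult_right[of _ "M + 1"])
      (auto simp: toeplitz_mat_def hankel_mat_def d_def)
  show "dim_row (gram_mat M r x w) = dim_row ?R" "dim_col (gram_mat M r x w) = dim_col ?R"
    unfolding R by (auto simp: gram_mat_def sampling_mat_def)
  fix k l assume "k < dim_row ?R" "l < dim_col ?R"
  then have kl: "k \<le> M" "l \<le> M"
    unfolding R by auto
  \<comment> \<open>The absolute value in the Toeplitz index is harmless because the cosine is
    even.\<close>
  have abs: "cos (pi * real (nat \<bar>int k - int l\<bar>) * u) = cos (pi * real k * u - pi * real l * u)" for u
  proof (cases "k \<le> l")
    case True
    then have "pi * real (nat \<bar>int k - int l\<bar>) * u = - (pi * real k * u - pi * real l * u)"
      by (simp add: algebra_simps of_nat_diff)
    then show ?thesis by (metis cos_minus)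
  next
    case False
    then have "pi * real (nat \<bar>int k - int l\<bar>) * u = pi * real k * u - pi * real l * u"
      by (simp add: algebra_simps of_nat_diff)
    then show ?thesis by simp
  qed
  have "gram_mat M r x w $$ (k, l)
      = (\<Sum>i<r. sampling_mat M r x w $$ (i, k) * sampling_mat M r x w $$ (i, l))"
    using sampling_mat_carrier[of M r x w] kl
    by (auto simp: gram_mat_def scalar_prod_def atLeast0LessThan)
  also have "\<dots> = (\<Sum>j=1..r. w j * (cos_basis k (x j) * cos_basis l (x j)))"
    using kl w unfolding One_nat_def sum.atLeast1_atMost_eq
    by (auto simp: sampling_mat_index intro!: sum.cong)
  also have "\<dots> = (\<Sum>j=1..r. d k * d l * (w j * (cos (pi * real (nat \<bar>int k - int l\<bar>) * x j) / 2
      + cos (pi * real (k + l) * x j) / 2)))"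
  proof (rule sum.cong)
    fix j
    have "cos_basis n u = d n * cos (pi * real n * u)" for n u
      by (simp add: cos_basis_def d_def)
    then have "cos_basis k (x j) * cos_basis l (x j)
        = d k * d l * (cos (pi * real k * x j) * cos (pi * real l * x j))"
      by simp
    also have "\<dots> = d k * d l * (cos (pi * real (nat \<bar>int k - int l\<bar>) * x j) / 2
        + cos (pi * real (k + l) * x j) / 2)"
      unfolding cos_times_cos abs by (simp add: algebra_simps add_divide_distrib)
    finally show "w j * (cos_basis k (x j) * cos_basis l (x j)) = d k * d l *
        (w j * (cos (pi * real (nat \<bar>int k - int l\<bar>) * x j) / 2 + cos (pi * real (k + l) * x j) / 2))"
      by simp
  qed simp
  also have "\<dots> = d k * (cos_moment r x w (nat \<bar>int k - int l\<bar>) + cos_moment r x w (k + l)) * d l"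
    by (simp add: cos_moment_def sum_distrib_left sum.distrib[symmetric] distrib_left mult_ac
        sum_divide_distrib)
  also have "\<dots> = ?R $$ (k, l)"
    unfolding R using kl by simp
  finally show "gram_mat M r x w $$ (k, l) = ?R $$ (k, l)" .
qed

text \<open>Positive weights turn a kernel vector into a cosine polynomial with \<open>r > M\<close>
  distinct zeros in \<open>[0, 1]\<close>.\<close>

lemma sampling_mat_trivial_kernel:
  assumes "strict_mono_on {1..r} x" "0 \<le> x 1" "x r \<le> 1" "M < r"
    and w: "\<And>j. j \<in> {1..r} \<Longrightarrow> 0 < w j"
    and c: "c \<in> carrier_vec (M + 1)" and ker: "sampling_mat M r x w *\<^sub>v c = 0\<^sub>v r"
  shows "c = 0\<^sub>v (M + 1)"
proof -
  have "cos_poly M c (x j) = 0" if j: "j \<in> {1..r}" for j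
  proof -
    obtain i where i: "j = Suc i" "i < r"
      using j by (cases j) auto
    have "vec_index (sampling_mat M r x w *\<^sub>v c) i = 0"
      unfolding ker using i by simp
    then show ?thesis
      unfolding sampling_mat_mult_vec[OF c] using i w[OF j] by simp
  qed
  moreover have "x ` {1..r} \<subseteq> {0..1}"
  proof (rule image_subsetI)
    fix j assume "j \<in> {1..r}"
    then have "x 1 \<le> x j" "x j \<le> x r"
      by (auto intro!: strict_mono_on_leD[OF assms(1)])
    then show "x j \<in> {0..1}"
      using assms(2,3) by simp
  qed
  moreover have "card (x ` {1..r}) = r"
    using strict_mono_on_imp_inj_on[OF assms(1)] by (simp add: card_image)
  ultimately have "cos_poly M c u = 0" for u
    using \<open>M < r\<close> by - (rule cos_poly_eq_0_if_many_zeros[of "x ` {1..r}"], auto)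
  then show ?thesis by (rule cos_poly_eq_0_imp_coeffs[OF c])
qed

text \<open>The error exceeds its value at \<open>c0\<close> by the squared norm of
  \<open>V (c - c0)\<close>. Hence \<open>c0\<close> is a minimiser, and injectivity of
  \<open>V\<close> makes its coefficient vector the only one.\<close>

lemma normal_equations_solve_least_squares:
  assumes w: "\<And>j. j \<in> {1..r} \<Longrightarrow> 0 \<le> w j"
    and ker: "\<And>v. v \<in> carrier_vec (M + 1) \<Longrightarrow> sampling_mat M r x w *\<^sub>v v = 0\<^sub>v r \<Longrightarrow> v = 0\<^sub>v (M + 1)"
  shows "invertible_mat (gram_mat M r x w)"
    and "c \<in> carrier_vec (M + 1) \<Longrightarrow>
      is_arg_min (lsq_error r x w s) (\<lambda>p. p \<in> cos_polys M) (cos_poly M c)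
        \<longleftrightarrow> c = mat_inv (gram_mat M r x w) *\<^sub>v normal_rhs M r x w s"
proof -
  let ?V = "sampling_mat M r x w" and ?A = "gram_mat M r x w" and ?b = "normal_rhs M r x w s"
  note V = sampling_mat_carrier[of M r x w]
  have A: "?A \<in> carrier_mat (M + 1) (M + 1)"
    using V unfolding gram_mat_def by simp
  have s: "weighted_samples r w s \<in> carrier_vec r"
    by (simp add: weighted_samples_def)
  have b: "?b \<in> carrier_vec (M + 1)"
    using V s by (simp add: normal_rhs_def)
  have "v = 0\<^sub>v (M + 1)" if "v \<in> carrier_vec (M + 1)" "?A *\<^sub>v v = 0\<^sub>v (M + 1)" for v
    using gram_trivial_kernel[OF V _ that[unfolded gram_mat_def]] ker by blast
  note inv = mat_inv_if_trivial_kernel[OF A this]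
  show "invertible_mat ?A" by (rule inv(1))
  define c0 where "c0 = mat_inv ?A *\<^sub>v ?b"
  have c0: "c0 \<in> carrier_vec (M + 1)"
    using inv(2) b by (simp add: c0_def)
  have "?A *\<^sub>v c0 = ?b"
    using assoc_mult_mat_vec[OF A inv(2) b] inv(3) b by (simp add: c0_def)
  then have normal: "(transpose_mat ?V * ?V) *\<^sub>v c0 = transpose_mat ?V *\<^sub>v weighted_samples r w s"
    by (simp add: gram_mat_def normal_rhs_def)
  let ?f = "\<lambda>c. lsq_error r x w s (cos_poly M c)"
  have excess: "?f c = ?f c0 + (?V *\<^sub>v (c - c0)) \<bullet> (?V *\<^sub>v (c - c0))" if "c \<in> carrier_vec (M + 1)" for c
    using least_squares_pythagoras[OF V s c0 that normal] lsq_error_cos_poly[OF that w]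
      lsq_error_cos_poly[OF c0 w] by simp
  assume c: "c \<in> carrier_vec (M + 1)"
  show "is_arg_min (lsq_error r x w s) (\<lambda>p. p \<in> cos_polys M) (cos_poly M c) \<longleftrightarrow> c = mat_inv ?A *\<^sub>v ?b"
    unfolding c0_def[symmetric]
  proof
    assume "is_arg_min (lsq_error r x w s) (\<lambda>p. p \<in> cos_polys M) (cos_poly M c)"
    then have "\<not> ?f c0 < ?f c"
      using c0 by (auto simp: is_arg_min_def cos_polys_def)
    then have "(?V *\<^sub>v (c - c0)) \<bullet> (?V *\<^sub>v (c - c0)) = 0"
      using excess[OF c] scalar_prod_self_nonneg[of "?V *\<^sub>v (c - c0)"] by linarith
    then have "c - c0 = 0\<^sub>v (M + 1)"
      using ker[of "c - c0"] V c c0 scalar_prod_self_eq_0_iff[of "?V *\<^sub>v (c - c0)" r] by simp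
    then have "vec_index (c - c0) k = 0" if "k < M + 1" for k
      using that by simp
    then show "c = c0"
      using c c0 by (intro eq_vecI) auto
  next
    assume "c = c0"
    moreover have "?f c0 \<le> ?f c'" if "c' \<in> carrier_vec (M + 1)" for c'
      using excess[OF that] scalar_prod_self_nonneg by simp
    ultimately show "is_arg_min (lsq_error r x w s) (\<lambda>p. p \<in> cos_polys M) (cos_poly M c)"
      using c by (auto simp: is_arg_min_def cos_polys_def not_less)
  qed
qed

section \<open>Condition number for adaptive weights\<close>

lemma cond_number_adaptive_weights:
  assumes r: "r \<ge> 1" and x: "strict_mono_on {1..r} x" "0 \<le> x 1" "x r \<le> 1"
    and M: "M \<ge> 1" and gap: "max_gap r x < 1 / real M"
  defines "A \<equiv> gram_mat M r x (adaptive_weight r x)"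
    and "t \<equiv> max_gap r x * real M"
  shows "invertible_mat A" "cond_number A \<le> (1 + t)\<^sup>2 / (1 - t)\<^sup>2"
proof -
  let ?e = "ext_points r x" and ?\<delta> = "max_gap r x" and ?w = "adaptive_weight r x"
  let ?V = "sampling_mat M r x ?w"
  have e_x: "?e j = x j" if "j \<in> {1..r}" for j
    using that by (auto simp: ext_points_def)
  have e_mono: "?e j \<le> ?e (j + 1)" if j: "j \<le> r" for j
  proof -
    \<comment> \<open>Monotonicity of \<open>x\<close> covers the inner gaps only; the two gaps at
      the reflected points follow from \<open>0 \<le> x 1\<close> and
      \<open>x r \<le> 1\<close>.\<close>
    consider "j = 0" | "j = r" "j \<noteq> 0" | "j \<in> {1..r}" "j + 1 \<in> {1..r}"
      using j by force
    then show ?thesis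
    proof cases
      case 3
      then show ?thesis
        using strict_mono_onD[OF x(1), of j "j + 1"] e_x by (simp add: less_imp_le)
    qed (use r x in \<open>auto simp: ext_points_def\<close>)
  qed
  have e_gap: "?e (j + 1) - ?e j \<le> ?\<delta>" if "j \<le> r" for j
  proof -
    have "\<bar>?e (j + 1) - ?e j\<bar> \<le> ?\<delta>"
      unfolding max_gap_def using that by (intro Max_ge) auto
    then show ?thesis by linarith
  qed
  \<comment> \<open>The Wirtinger step requires a positive half-cell bound. Were all gaps
    nonpositive, the end gaps would force \<open>x 1 \<le> 0\<close> and \<open>1 \<le> x r\<close>,
    so \<open>r\<close> would be at least 2 and the gap \<open>x 2 - x 1\<close> positive.\<close>
  have \<delta>: "0 < ?\<delta>"
  proof (rule ccontr)
    assume "\<not> 0 < ?\<delta>"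
    then have "x 1 \<le> 0" "1 \<le> x r"
      using e_gap[of 0] e_gap[of r] r by (auto simp: ext_points_def)
    then have "r \<noteq> 1" by auto
    then have "x 1 < x 2"
      using r by (intro strict_mono_onD[OF x(1)]) auto
    moreover have "x 2 - x 1 \<le> ?\<delta>"
      using e_gap[of 1] e_x[of 1] e_x[of 2] r \<open>r \<noteq> 1\<close> by (simp add: numeral_2_eq_2)
    ultimately show False
      using \<open>\<not> 0 < ?\<delta>\<close> by linarith
  qed
  \<comment> \<open>Midpoints of consecutive points are the cell boundaries. The outer points are
    the reflections of \<open>x 1\<close> at 0 and of \<open>x r\<close> at 1, so the cells tile
    exactly \<open>[0, 1]\<close>.\<close>
  define y where "y j = (?e j + ?e (j + 1)) / 2" for j
  have y_ends: "y 0 = 0" "y r = 1"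
    using r by (auto simp: y_def ext_points_def)
  have cell: "y (j - 1) \<le> x j \<and> x j \<le> y j \<and> x j - y (j - 1) \<le> ?\<delta> / 2 \<and> y j - x j \<le> ?\<delta> / 2"
    if j: "j \<in> {1..r}" for j
  proof -
    have "j - 1 \<le> r" "j \<le> r" "j - 1 + 1 = j" using j by auto
    then show ?thesis
      using e_mono[of "j - 1"] e_mono[of j] e_gap[of "j - 1"] e_gap[of j] e_x[OF j]
      by (auto simp: y_def field_simps)
  qed
  have w: "?w j = y j - y (j - 1)" if "j \<in> {1..r}" for j
    using that by (simp add: adaptive_weight_def y_def field_simps)
  have w0: "0 \<le> ?w j" if "j \<in> {1..r}" for j
    using w[OF that] cell[OF that] by linarith
  have t: "0 < t" "t < 1"
    using \<delta> M gap by (simp_all add: t_def field_simps)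
  \<comment> \<open>The parameter of the sandwich for \<open>L = \<delta> / 2\<close> and the
    Bernstein constant \<open>B = pi * M\<close>.\<close>
  have t_eq: "2 * (?\<delta> / 2) * (pi * real M) / pi = t"
    by (simp add: t_def)
  have bounds: "(1 - t)\<^sup>2 / 2 * (c \<bullet> c) \<le> (?V *\<^sub>v c) \<bullet> (?V *\<^sub>v c)"
      "(?V *\<^sub>v c) \<bullet> (?V *\<^sub>v c) \<le> (1 + t)\<^sup>2 / 2 * (c \<bullet> c)"
    if c: "c \<in> carrier_vec (M + 1)" for c
  proof -
    have "continuous_on UNIV (cos_poly_deriv M c)"
      unfolding cos_poly_deriv_def by (intro continuous_intros)
    note sandwich = point_evaluation_sandwich[of "cos_poly M c" "cos_poly_deriv M c" r y x "?\<delta> / 2" "pi * real M",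
        OF cos_poly_has_derivative this cell, unfolded y_ends t_eq, OF _ _ _ bernstein_cos_poly]
    have P: "integral {0..1} (\<lambda>u. (cos_poly M c u)\<^sup>2) = (c \<bullet> c) / 2"
      using c integral_unique[OF has_integral_cos_poly_squared[of M c]]
      by (simp add: scalar_prod_self lessThan_Suc_atMost)
    have "(\<Sum>j=1..r. (y j - y (j - 1)) * (cos_poly M c (x j))\<^sup>2)
        = (\<Sum>j=1..r. ?w j * (cos_poly M c (x j))\<^sup>2)"
      using w by (intro sum.cong) auto
    also have "\<dots> = (?V *\<^sub>v c) \<bullet> (?V *\<^sub>v c)"
      by (rule sampling_mat_quadratic_form[symmetric, OF c w0])
    finally have S: "(\<Sum>j=1..r. (y j - y (j - 1)) * (cos_poly M c (x j))\<^sup>2)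
        = (?V *\<^sub>v c) \<bullet> (?V *\<^sub>v c)" .
    show "(1 - t)\<^sup>2 / 2 * (c \<bullet> c) \<le> (?V *\<^sub>v c) \<bullet> (?V *\<^sub>v c)"
      using sandwich(2) \<delta> M t unfolding P S by simp
    show "(?V *\<^sub>v c) \<bullet> (?V *\<^sub>v c) \<le> (1 + t)\<^sup>2 / 2 * (c \<bullet> c)"
      using sandwich(1) \<delta> M unfolding P S by simp
  qed
  have "0 < (1 - t)\<^sup>2 / 2" using t by simp
  note result = cond_number_gram_le[OF sampling_mat_carrier this _ bounds, folded gram_mat_def A_def]
  show "invertible_mat A" by (rule result) auto
  have "cond_number A \<le> ((1 + t)\<^sup>2 / 2) / ((1 - t)\<^sup>2 / 2)" by (rule result) auto
  then show "cond_number A \<le> (1 + t)\<^sup>2 / (1 - t)\<^sup>2" by simp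
qed

theorem theorem2p1:
  fixes M r :: nat and x s w :: "nat \<Rightarrow> real"
  assumes "r \<ge> 1"
    and "0 \<le> x 1" and "strict_mono_on {1..r} x" and "x r \<le> 1"
    and "\<And>j. j \<in> {1..r} \<Longrightarrow> w j > 0"
  shows "gram_mat M r x w =
           scale_mat M * (toeplitz_mat M (cos_moment r x w) + hankel_mat M (cos_moment r x w))
             * scale_mat M
    \<and> (M < r \<longrightarrow>
         invertible_mat (gram_mat M r x w) \<and>
         (\<forall>c \<in> carrier_vec (M + 1).
            is_arg_min (lsq_error r x w s) (\<lambda>p. p \<in> cos_polys M) (cos_poly M c)
              \<longleftrightarrow> c = mat_inv (gram_mat M r x w) *\<^sub>v normal_rhs M r x w s))
    \<and> (M \<ge> 1 \<and> max_gap r x < 1 / real M \<longrightarrow>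
         invertible_mat (gram_mat M r x (adaptive_weight r x)) \<and>
         cond_number (gram_mat M r x (adaptive_weight r x))
           \<le> (1 + max_gap r x * real M)\<^sup>2 / (1 - max_gap r x * real M)\<^sup>2)"
proof (intro conjI impI ballI)
  have w: "0 \<le> w j" if "j \<in> {1..r}" for j
    using assms(5)[OF that] by simp
  show "gram_mat M r x w =
      scale_mat M * (toeplitz_mat M (cos_moment r x w) + hankel_mat M (cos_moment r x w)) * scale_mat M"
    by (rule gram_mat_toeplitz_hankel[OF w])
  {
    assume "M < r"
    have ker: "v = 0\<^sub>v (M + 1)"
      if "v \<in> carrier_vec (M + 1)" "sampling_mat M r x w *\<^sub>v v = 0\<^sub>v r" for v
      by (rule sampling_mat_trivial_kernel[OF assms(3,2,4) \<open>M < r\<close> assms(5) that])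
    show "invertible_mat (gram_mat M r x w)"
      by (rule normal_equations_solve_least_squares(1)[OF w ker])
    show "is_arg_min (lsq_error r x w s) (\<lambda>p. p \<in> cos_polys M) (cos_poly M c)
        \<longleftrightarrow> c = mat_inv (gram_mat M r x w) *\<^sub>v normal_rhs M r x w s"
      if "c \<in> carrier_vec (M + 1)" for c
      by (rule normal_equations_solve_least_squares(2)[OF w ker that])
  }
  assume "M \<ge> 1 \<and> max_gap r x < 1 / real M"
  then show "invertible_mat (gram_mat M r x (adaptive_weight r x))"
    "cond_number (gram_mat M r x (adaptive_weight r x))
      \<le> (1 + max_gap r x * real M)\<^sup>2 / (1 - max_gap r x * real M)\<^sup>2"
    using cond_number_adaptive_weights[OF assms(1,3,2,4)] by auto
qed

end
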